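(* Let $q$ be an indeterminate. For every integer $m\ge 1$, the following identity holds: $$\sum_{\substack{|\lambda|=2m\\ m_i(\lambda)\text{ even for every odd } i}} \frac{1-q^{-\lambda_1'}}{q^{\frac12\sum_{i\ge1}(\lambda_i')^2+\frac{o(\lambda)}{2}}\ \prod_{i\ge1}(1/q^2;1/q^2)_{\lfloor m_i(\lambda)/2\rfloor}} = \frac{1}{q^m(q+1)}\sum_{i=1}^m\frac{(-1)^{i-1}(q^{2i+1}+1)}{q^{i(i+1)}\,(1/q^2;1/q^2)_{m-i}},$$ where the sum on the left is over all integer partitions $\lambda$ of $2m$ in which every odd part size occurs with even multiplicity (possibly zero).
   Context: For a non-negative integer $n$, $(A;Q)_n=\prod_{k=0}^{n-1}(1-AQ^k)$, with $(A;Q)_0=1$. For an integer partition $\lambda$: $|\lambda|$ is its size; $m_i(\lambda)$ is the number of parts of $\lambda$ equal to $i$; $o(\lambda)$ is the number of odd parts of $\lambda$ (counted with multiplicity); $\lambda_i'=\sum_{j\ge i}m_j(\lambda)$, so $\lambda_1'$ is the number of parts of $\lambda$. *)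

theory Defs
  imports "HOL-Library.Multiset" "HOL-Computational_Algebra.Computational_Algebra"
begin

definition qpoch :: "'a::comm_ring_1 \<Rightarrow> 'a \<Rightarrow> nat \<Rightarrow> 'a" where
  "qpoch A Q n = (\<Prod>k<n. 1 - A * Q ^ k)"

text \<open>An integer partition is the finite multiset of its (positive) parts,
  so that the multiplicity of \<open>i\<close> in \<open>\<mu>\<close> is \<open>count \<mu> i\<close>.\<close>

definition partitions_of :: "nat \<Rightarrow> nat multiset set" where
  "partitions_of n = {\<mu>. 0 \<notin># \<mu> \<and> sum_mset \<mu> = n}"

definition conj_part :: "nat multiset \<Rightarrow> nat \<Rightarrow> nat" where
  "conj_part \<mu> i = (\<Sum>j \<in> {j \<in> set_mset \<mu>. i \<le> j}. count \<mu> j)"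

definition odd_parts :: "nat multiset \<Rightarrow> nat" where
  "odd_parts \<mu> = size (filter_mset odd \<mu>)"

text \<open>Every part of \<open>\<mu>\<close> is at most \<open>sum_mset \<mu>\<close>, so the conjugate parts beyond this index
  vanish and the following is the full sum of squares over all \<open>i \<ge> 1\<close>.\<close>

definition conj_sum_squares :: "nat multiset \<Rightarrow> nat" where
  "conj_sum_squares \<mu> = (\<Sum>i = 1..sum_mset \<mu>. (conj_part \<mu> i)\<^sup>2)"

text \<open>The indeterminate, as an element of the field of rational functions over the rationals.\<close>

definition qvar :: "rat poly fract" where
  "qvar = to_fract [:0, 1:]"

lemma count_eq_0_beyond_sum:
  fixes \<mu> :: "nat multiset"
  assumes "sum_mset \<mu> < i"
  shows "count \<mu> i = 0"
proof (rule ccontr)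
  assume "count \<mu> i \<noteq> 0"
  then have "i \<in># \<mu>" by (simp add: not_in_iff)
  then have "i \<le> sum_mset \<mu>" by (metis insert_DiffM le_add1 sum_mset.add_mset)
  with assms show False by simp
qed

lemma conj_part_eq_size: "conj_part \<mu> i = size (filter_mset (\<lambda>j. i \<le> j) \<mu>)"
  unfolding conj_part_def size_multiset_overloaded_eq
  by (intro sum.cong) auto

lemma conj_part_eq_0_beyond_sum:
  assumes "sum_mset \<mu> < i"
  shows "conj_part \<mu> i = 0"
  unfolding conj_part_def
  using assms by (intro sum.neutral) (auto intro!: count_eq_0_beyond_sum)

lemma finite_partitions_of: "finite (partitions_of n)"
proof -
  have le: "size \<mu> \<le> sum_mset \<mu>" if "0 \<notin># \<mu>" for \<mu> :: "nat multiset"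
    using that by (induction \<mu>) auto
  have "\<mu> \<in> mset ` {xs. set xs \<subseteq> {..n} \<and> length xs \<le> n}" if "\<mu> \<in> partitions_of n" for \<mu>
  proof -
    obtain xs where xs: "mset xs = \<mu>" using ex_mset by blast
    have sum: "sum_mset \<mu> = n" and nz: "0 \<notin># \<mu>"
      using that by (auto simp: partitions_of_def)
    have "set xs \<subseteq> {..n}"
    proof
      fix i assume "i \<in> set xs"
      then have "count \<mu> i \<noteq> 0" using xs by auto
      then show "i \<in> {..n}" using count_eq_0_beyond_sum[of \<mu> i] sum by force
    qed
    moreover have "length xs \<le> n" using le[OF nz] sum xs by auto
    ultimately show ?thesis using xs by blast
  qed
  then have "partitions_of n \<subseteq> mset ` {xs. set xs \<subseteq> {..n} \<and> length xs \<le> n}" by blast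
  then show ?thesis
    by (rule finite_subset) (intro finite_imageI finite_lists_length_le finite_atMost)
qed

lemma sum_conj_part: "(\<Sum>i = 1..sum_mset \<mu>. conj_part \<mu> i) = sum_mset \<mu>"
proof -
  have "(\<Sum>i = 1..N. size (filter_mset (\<lambda>j. i \<le> j) \<mu>)) = sum_mset \<mu>"
    if "\<forall>j \<in># \<mu>. j \<le> N" for N
    using that
  proof (induction \<mu>)
    case (add x \<mu>)
    have "(\<Sum>i = 1..N. size (filter_mset (\<lambda>j. i \<le> j) (add_mset x \<mu>)))
        = (\<Sum>i = 1..N. (if i \<le> x then 1 else 0) + size (filter_mset (\<lambda>j. i \<le> j) \<mu>))"
      by (intro sum.cong) auto
    also have "\<dots> = (\<Sum>i = 1..N. if i \<le> x then 1 else 0) + sum_mset \<mu>"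
      using add by (simp add: sum.distrib)
    also have "(\<Sum>i = 1..N. if i \<le> x then 1 else 0) = card ({1..N} \<inter> {i. i \<le> x})"
      by (simp flip: sum.inter_restrict add: sum.If_cases)
    also have "{1..N} \<inter> {i. i \<le> x} = {1..x}" using add.prems by auto
    finally show ?case by simp
  qed simp
  moreover have "\<forall>j \<in># \<mu>. j \<le> sum_mset \<mu>"
    using count_eq_0_beyond_sum[of \<mu>] by (metis count_eq_zero_iff linorder_not_less)
  ultimately show ?thesis by (simp add: conj_part_eq_size)
qed

text \<open>The divisions by two in the exponent on the left-hand side of the identity are exact.\<close>

lemma even_conj_sum_squares:
  assumes "even (sum_mset \<mu>)"
  shows "even (conj_sum_squares \<mu>)"
proof -
  have "even (\<Sum>i\<in>A. (f i)\<^sup>2) \<longleftrightarrow> even (\<Sum>i\<in>A. f i)" if "finite A" for A and f :: "nat \<Rightarrow> nat"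
    using that by (induction A) auto
  then show ?thesis
    using assms sum_conj_part[of \<mu>] unfolding conj_sum_squares_def by simp
qed

lemma even_odd_parts:
  assumes "\<forall>i. odd i \<longrightarrow> even (count \<mu> i)"
  shows "even (odd_parts \<mu>)"
  unfolding odd_parts_def size_multiset_overloaded_eq
  using assms by (intro dvd_sum) auto

end

theory Submission
  imports Defs
begin

text \<open>
  Put \<open>t = 1/q\<close> and \<open>Q = t\<^sup>2\<close>, write \<open>r\<^sub>n = 1/(Q;Q)\<^sub>n\<close> and \<open>[n,k]\<close> for the Gaussian binomial
  coefficient in base \<open>Q\<close>.  Since \<open>\<lambda>'\<^sub>1\<close> is the number of parts, the left-hand side is
  \<open>\<Sum>\<^sub>k (1 - t\<^sup>k) S(k, 2m)\<close>, where \<open>S(k, n)\<close> collects the weights of the partitions of \<open>n\<close> into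
  exactly \<open>k\<close> parts.  The key fact is that each \<open>S(k, 2m)\<close> is a monomial times \<open>r\<^sub>j [m-1, i]\<close> for
  suitable \<open>i\<close> and \<open>j\<close>.

  To see this, delete the first column of the Young diagram.  All parts drop by one, so
  the parity condition now concerns even parts and the number of odd parts enters the exponent
  with the opposite sign.  Hence a companion family \<open>O(k, n)\<close> is needed: even parts have even
  multiplicity and the exponent is \<open>(\<Sum>\<lambda>'\<^sub>i\<^sup>2 - o(\<lambda>))/2\<close>.  (The two families are indexed by the
  Jordan types of nilpotent elements of symplectic and orthogonal Lie algebras.)  Each of
  \<open>S\<close> and \<open>O\<close> is a convolution of the other with the sequence \<open>r\<close>
  (lemmas \<open>sp_sum_rec\<close> and \<open>orth_sum_rec\<close>), and the closed forms satisfy the same two recurrences.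
  In all four parity cases the verification comes down to one summation formula, the \<open>q\<close>-analogue
  of Vandermonde's convolution (lemma \<open>q_vandermonde\<close>).

  Inserting the closed forms reduces the theorem to a statement on the sums
  \<open>D\<^sub>c(M) = \<Sum>\<^sub>j Q\<^bsup>j(j+c)\<^esup> r\<^sub>j [M,j]\<close> with \<open>M = m - 1\<close>: the left-hand side becomes
  \<open>t\<^sup>m (D\<^sub>1 + (Q - t) D\<^sub>2)\<close>.  Here \<open>D\<^sub>0(M) = r\<^sub>M\<close>; the sum \<open>D\<^sub>1(M)\<close> is a coefficient of
  a partial theta function divided by an infinite product, because both satisfy the same
  first-order recurrence (lemma \<open>durfee_sum_1_eq_partial_theta_coeff\<close>); and \<open>D\<^sub>2\<close> is expressed
  through \<open>D\<^sub>0\<close> and \<open>D\<^sub>1\<close> by a contiguous relation (lemma \<open>durfee_sum_contiguous\<close>).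
\<close>

section \<open>Gaussian binomial coefficients and the \<open>q\<close>-Vandermonde convolution\<close>

definition inv_qpoch :: "'a::field \<Rightarrow> nat \<Rightarrow> 'a" where
  "inv_qpoch Q n = inverse (qpoch Q Q n)"

fun gbinom :: "'a::comm_ring_1 \<Rightarrow> nat \<Rightarrow> nat \<Rightarrow> 'a" where
  "gbinom Q n 0 = 1"
| "gbinom Q 0 (Suc k) = 0"
| "gbinom Q (Suc n) (Suc k) = Q ^ Suc k * gbinom Q n (Suc k) + gbinom Q n k"

lemma gbinom_eq_0: "n < k \<Longrightarrow> gbinom Q n k = 0"
  by (induction Q n k rule: gbinom.induct) auto

lemma gbinom_diag [simp]: "gbinom Q n n = 1"
  by (induction n) (auto simp: gbinom_eq_0)

text \<open>The other \<open>q\<close>-Pascal rule.  When \<open>k > n\<close> the truncated exponent is harmless, as then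
  \<open>gbinom Q n k\<close> vanishes.\<close>

lemma gbinom_pascal: "gbinom Q (Suc n) (Suc k) = gbinom Q n (Suc k) + Q ^ (n - k) * gbinom Q n k"
proof (induction n arbitrary: k)
  case 0
  show ?case by (cases k) auto
next
  case (Suc n)
  show ?case
  proof (cases k)
    case 0
    have "gbinom Q (Suc (Suc n)) (Suc 0) = Q * gbinom Q (Suc n) (Suc 0) + 1" by simp
    also have "\<dots> = Q * (gbinom Q n (Suc 0) + Q ^ n) + 1"
      using Suc[of 0] by simp
    also have "\<dots> = gbinom Q (Suc n) (Suc 0) + Q ^ Suc n" by (simp add: algebra_simps)
    finally show ?thesis using 0 by simp
  next
    case (Suc k')
    show ?thesis
    proof (cases "k' < n")
      case True
      then obtain a where a: "n = Suc k' + a"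
        using less_iff_Suc_add[of k' n] by auto
      have "gbinom Q (Suc (Suc n)) (Suc k)
          = Q ^ Suc k * (gbinom Q n (Suc k) + Q ^ (n - k) * gbinom Q n k)
            + (gbinom Q n (Suc k') + Q ^ (n - k') * gbinom Q n k')"
        using Suc Suc.IH[of k] Suc.IH[of k'] by (metis gbinom.simps(3))
      also have "\<dots> = gbinom Q (Suc n) (Suc k) + Q ^ (Suc n - k) * gbinom Q (Suc n) k"
        using Suc a by (simp add: algebra_simps power_add)
      finally show ?thesis .
    next
      case False
      then show ?thesis using Suc by (cases "k' = n") (auto simp: gbinom_eq_0)
    qed
  qed
qed

lemma qpoch_Suc: "qpoch Q Q (Suc n) = (1 - Q ^ Suc n) * qpoch Q Q n"
  by (simp add: qpoch_def)

lemma inv_qpoch_zero [simp]: "inv_qpoch Q 0 = 1"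
  by (simp add: inv_qpoch_def qpoch_def)

text \<open>With \<open>c = 0\<close> these are the sums over the size \<open>j\<close> of the Durfee square.\<close>

definition durfee_sum :: "'a::field \<Rightarrow> nat \<Rightarrow> nat \<Rightarrow> 'a" where
  "durfee_sum Q c m = (\<Sum>j\<le>m. Q ^ (j * (j + c)) * inv_qpoch Q j * gbinom Q m j)"

text \<open>The coefficient of \<open>z\<^sup>m\<close> in \<open>(\<Sum>i. (-z)\<^sup>i Q\<^bsup>i(i+1)/2\<^esup>) / (z;Q)\<^sub>\<infinity>\<close>, since \<open>1/(z;Q)\<^sub>\<infinity> = \<Sum>n. z\<^sup>n/(Q;Q)\<^sub>n\<close>.\<close>

definition partial_theta_coeff :: "'a::field \<Rightarrow> nat \<Rightarrow> 'a" where
  "partial_theta_coeff Q m = (\<Sum>i\<le>m. (-1) ^ i * Q ^ (Suc i choose 2) * inv_qpoch Q (m - i))"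

context
  fixes Q :: "'a::field"
  assumes generic: "\<And>k. Q ^ Suc k \<noteq> 1"
begin

lemma inv_qpoch_rec: "inv_qpoch Q n = (1 - Q ^ Suc n) * inv_qpoch Q (Suc n)"
  using generic[of n] unfolding inv_qpoch_def qpoch_Suc by (simp del: power_Suc)

lemma gbinom_qpoch: "gbinom Q (k + s) k * (qpoch Q Q k * qpoch Q Q s) = qpoch Q Q (k + s)"
proof (induction "k + s" arbitrary: k s)
  case 0
  then show ?case by (simp add: qpoch_def)
next
  case (Suc n)
  show ?case
  proof (cases "k = 0 \<or> s = 0")
    case True
    then show ?thesis by (auto simp: qpoch_def)
  next
    case False
    then obtain k' s' where ks: "k = Suc k'" "s = Suc s'"
      by (metis not0_implies_Suc)
    have 1: "gbinom Q (k + s') k * (qpoch Q Q k * qpoch Q Q s') = qpoch Q Q (k + s')"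
      using Suc.hyps(1)[of k s'] Suc.hyps(2) ks(2) by simp
    have 2: "gbinom Q (k' + s) k' * (qpoch Q Q k' * qpoch Q Q s) = qpoch Q Q (k + s')"
      using Suc.hyps(1)[of k' s] Suc.hyps(2) ks by simp
    have "gbinom Q (k + s) k * (qpoch Q Q k * qpoch Q Q s)
      = Q ^ k * gbinom Q (k + s') k * (qpoch Q Q k * qpoch Q Q s)
        + gbinom Q (k' + s) k' * (qpoch Q Q k * qpoch Q Q s)"
      using ks by (simp add: algebra_simps)
    also have "\<dots> = Q ^ k * (1 - Q ^ s) * (gbinom Q (k + s') k * (qpoch Q Q k * qpoch Q Q s'))
        + (1 - Q ^ k) * (gbinom Q (k' + s) k' * (qpoch Q Q k' * qpoch Q Q s))"
      unfolding ks qpoch_Suc by (simp only: algebra_simps)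
    also have "\<dots> = (1 - Q ^ (k + s)) * qpoch Q Q (k + s')"
      unfolding 1 2 by (simp add: algebra_simps power_add)
    also have "\<dots> = qpoch Q Q (k + s)" using ks qpoch_Suc[of Q "k + s'"] by simp
    finally show ?thesis .
  qed
qed

lemma qpoch_nonzero: "qpoch Q Q n \<noteq> 0"
  using generic unfolding qpoch_def by (auto simp flip: power_Suc)

lemma gbinom_inv_qpoch: "inv_qpoch Q (k + s) * gbinom Q (k + s) k = inv_qpoch Q k * inv_qpoch Q s"
proof -
  have "gbinom Q (k + s) k \<noteq> 0"
    using gbinom_qpoch[of k s] qpoch_nonzero[of "k + s"] by auto
  then show ?thesis
    using qpoch_nonzero by (simp add: inv_qpoch_def field_simps flip: gbinom_qpoch[of k s])
qed

text \<open>By the second Pascal rule, raising \<open>b\<close> by one adds \<open>Q\<^bsup>s+b+1\<^esup>\<close> times the same sum with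
  \<open>(k, s)\<close> replaced by \<open>(k - 1, s + 1)\<close>, and the right-hand side changes in the same way.  The shift
  \<open>s\<close> varies in the induction, even for the case \<open>s = 0\<close>.\<close>

lemma q_vandermonde:
  "(\<Sum>j\<le>k. Q ^ (j * (j + s)) * inv_qpoch Q (j + s) * inv_qpoch Q (k - j) * gbinom Q b j)
    = inv_qpoch Q (k + s) * gbinom Q (k + s + b) k"
proof (induction b arbitrary: k s)
  case 0
  have "(\<Sum>j\<le>k. Q ^ (j * (j + s)) * inv_qpoch Q (j + s) * inv_qpoch Q (k - j) * gbinom Q 0 j)
      = (\<Sum>j\<in>{0}. Q ^ (j * (j + s)) * inv_qpoch Q (j + s) * inv_qpoch Q (k - j) * gbinom Q 0 j)"
    by (rule sum.mono_neutral_right) (auto simp: gbinom_eq_0)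
  then show ?case using gbinom_inv_qpoch[of k s] by simp
next
  case (Suc b)
  show ?case
  proof (cases k)
    case 0
    then show ?thesis by simp
  next
    case (Suc k')
    let ?f = "\<lambda>c j. Q ^ (j * (j + s)) * inv_qpoch Q (j + s) * inv_qpoch Q (k - j) * gbinom Q c j"
    have step: "?f (Suc b) (Suc j) = ?f b (Suc j) + Q ^ (s + b + 1) *
        (Q ^ (j * (j + Suc s)) * inv_qpoch Q (j + Suc s) * inv_qpoch Q (k' - j) * gbinom Q b j)" for j
    proof (cases "j \<le> b")
      case True
      then obtain a where a: "b = j + a" using le_Suc_ex by blast
      show ?thesis
        unfolding gbinom_pascal using Suc a by (simp add: algebra_simps power_add)
    next
      case False
      then show ?thesis by (simp add: gbinom_eq_0)
    qed
    have "(\<Sum>j\<le>k. ?f (Suc b) j) = ?f (Suc b) 0 + (\<Sum>j\<le>k'. ?f (Suc b) (Suc j))"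
      unfolding Suc by (rule sum.atMost_Suc_shift)
    also have "\<dots> = ?f b 0 + (\<Sum>j\<le>k'. ?f b (Suc j)) + Q ^ (s + b + 1) *
        (\<Sum>j\<le>k'. Q ^ (j * (j + Suc s)) * inv_qpoch Q (j + Suc s) * inv_qpoch Q (k' - j) * gbinom Q b j)"
      unfolding step sum.distrib sum_distrib_left by simp
    also have "?f b 0 + (\<Sum>j\<le>k'. ?f b (Suc j)) = (\<Sum>j\<le>k. ?f b j)"
      unfolding Suc by (rule sum.atMost_Suc_shift [symmetric])
    also have "\<dots> + Q ^ (s + b + 1) *
        (\<Sum>j\<le>k'. Q ^ (j * (j + Suc s)) * inv_qpoch Q (j + Suc s) * inv_qpoch Q (k' - j) * gbinom Q b j)
      = inv_qpoch Q (k + s) * (gbinom Q (k + s + b) k + Q ^ (s + b + 1) * gbinom Q (k + s + b) k')"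
      unfolding Suc.IH using Suc by (simp add: algebra_simps)
    also have "\<dots> = inv_qpoch Q (k + s) * gbinom Q (k + s + Suc b) k"
      using gbinom_pascal[of Q "k + s + b" k'] Suc by (simp add: add.commute del: gbinom.simps)
    finally show ?thesis .
  qed
qed

text \<open>The formal limit \<open>k \<rightarrow> \<infinity>\<close> of \<open>q_vandermonde\<close>, by the same induction.\<close>

lemma q_vandermonde_limit:
  "(\<Sum>j\<le>b. Q ^ (j * (j + s)) * inv_qpoch Q (j + s) * gbinom Q b j) = inv_qpoch Q (s + b)"
proof (induction b arbitrary: s)
  case 0
  show ?case by simp
next
  case (Suc b)
  let ?f = "\<lambda>c j. Q ^ (j * (j + s)) * inv_qpoch Q (j + s) * gbinom Q c j"
  have step: "?f (Suc b) (Suc j) = ?f b (Suc j) + Q ^ (s + b + 1) *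
      (Q ^ (j * (j + Suc s)) * inv_qpoch Q (j + Suc s) * gbinom Q b j)" if le: "j \<le> b" for j
  proof -
    obtain a where a: "b = j + a" using le le_Suc_ex by blast
    show ?thesis
      unfolding gbinom_pascal using a by (simp add: algebra_simps power_add)
  qed
  have "(\<Sum>j\<le>Suc b. ?f (Suc b) j) = ?f (Suc b) 0 + (\<Sum>j\<le>b. ?f (Suc b) (Suc j))"
    by (rule sum.atMost_Suc_shift)
  also have "(\<Sum>j\<le>b. ?f (Suc b) (Suc j)) = (\<Sum>j\<le>b. ?f b (Suc j)) + Q ^ (s + b + 1) *
      (\<Sum>j\<le>b. Q ^ (j * (j + Suc s)) * inv_qpoch Q (j + Suc s) * gbinom Q b j)"
    unfolding sum_distrib_left sum.distrib [symmetric] by (rule sum.cong) (use step in auto)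
  also have "?f (Suc b) 0 + \<dots> = (\<Sum>j\<le>Suc b. ?f b j) + Q ^ (s + b + 1) *
      (\<Sum>j\<le>b. Q ^ (j * (j + Suc s)) * inv_qpoch Q (j + Suc s) * gbinom Q b j)"
    unfolding sum.atMost_Suc_shift[of "?f b"] by simp
  also have "(\<Sum>j\<le>Suc b. ?f b j) = (\<Sum>j\<le>b. ?f b j)"
    by (simp add: gbinom_eq_0)
  also have "\<dots> + Q ^ (s + b + 1) *
      (\<Sum>j\<le>b. Q ^ (j * (j + Suc s)) * inv_qpoch Q (j + Suc s) * gbinom Q b j) = inv_qpoch Q (s + Suc b)"
    unfolding Suc using inv_qpoch_rec[of "s + b"] by (simp add: algebra_simps)
  finally show ?case .
qed

section \<open>Durfee sums and a partial theta function\<close>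

lemma durfee_sum_0: "durfee_sum Q 0 m = inv_qpoch Q m"
  using q_vandermonde_limit[of 0 m] by (simp add: durfee_sum_def)

text \<open>The first Pascal rule, split into its two terms.  For \<open>c = 0\<close> the left-hand side is known, which
  evaluates the sum on the right.\<close>

lemma durfee_sum_Suc:
  "durfee_sum Q c (Suc m) = durfee_sum Q (Suc c) m
    + Q ^ Suc c * (\<Sum>j\<le>m. Q ^ (j * (j + c + 2)) * inv_qpoch Q (Suc j) * gbinom Q m j)"
proof -
  let ?f = "\<lambda>j. Q ^ (j * (j + c)) * inv_qpoch Q j"
  have "durfee_sum Q c (Suc m) = ?f 0 + (\<Sum>j\<le>m. ?f (Suc j) * gbinom Q (Suc m) (Suc j))"
    unfolding durfee_sum_def by (subst sum.atMost_Suc_shift) simp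
  also have "\<dots> = (?f 0 + (\<Sum>j\<le>m. ?f (Suc j) * Q ^ Suc j * gbinom Q m (Suc j)))
      + (\<Sum>j\<le>m. ?f (Suc j) * gbinom Q m j)"
    by (simp add: sum.distrib algebra_simps)
  also have "?f 0 + (\<Sum>j\<le>m. ?f (Suc j) * Q ^ Suc j * gbinom Q m (Suc j))
      = (\<Sum>j\<le>Suc m. ?f j * Q ^ j * gbinom Q m j)"
    by (subst sum.atMost_Suc_shift) simp
  also have "\<dots> = durfee_sum Q (Suc c) m"
    unfolding durfee_sum_def by (simp add: gbinom_eq_0 algebra_simps power_add)
  also have "(\<Sum>j\<le>m. ?f (Suc j) * gbinom Q m j)
      = Q ^ Suc c * (\<Sum>j\<le>m. Q ^ (j * (j + c + 2)) * inv_qpoch Q (Suc j) * gbinom Q m j)"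
    unfolding sum_distrib_left by (rule sum.cong) (simp_all add: algebra_simps power_add)
  finally show ?thesis .
qed

text \<open>Expanding with the second Pascal rule leaves exactly the sum that \<open>durfee_sum_Suc\<close> evaluates for
  \<open>c = 0\<close>.\<close>

lemma durfee_sum_1_rec: "durfee_sum Q 1 (Suc m) = (1 - Q ^ Suc m) * durfee_sum Q 1 m + Q ^ Suc m * inv_qpoch Q (Suc m)"
proof -
  let ?f = "\<lambda>j. Q ^ (j * (j + 1)) * inv_qpoch Q j"
  let ?Y = "\<Sum>j\<le>m. Q ^ (j * (j + 2)) * inv_qpoch Q (Suc j) * gbinom Q m j"
  have "durfee_sum Q 1 (Suc m) = ?f 0 + (\<Sum>j\<le>m. ?f (Suc j) * gbinom Q (Suc m) (Suc j))"
    unfolding durfee_sum_def by (subst sum.atMost_Suc_shift) simp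
  also have "\<dots> = (?f 0 + (\<Sum>j\<le>m. ?f (Suc j) * gbinom Q m (Suc j)))
      + (\<Sum>j\<le>m. ?f (Suc j) * Q ^ (m - j) * gbinom Q m j)"
    unfolding gbinom_pascal by (simp add: sum.distrib algebra_simps)
  also have "?f 0 + (\<Sum>j\<le>m. ?f (Suc j) * gbinom Q m (Suc j)) = (\<Sum>j\<le>Suc m. ?f j * gbinom Q m j)"
    by (subst sum.atMost_Suc_shift) simp
  also have "\<dots> = durfee_sum Q 1 m"
    unfolding durfee_sum_def by (simp add: gbinom_eq_0)
  also have "(\<Sum>j\<le>m. ?f (Suc j) * Q ^ (m - j) * gbinom Q m j) = Q ^ Suc m * (Q * ?Y)"
    unfolding sum_distrib_left
  proof (rule sum.cong)
    fix j assume "j \<in> {..m}"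
    then obtain a where "m = j + a" using le_Suc_ex by auto
    then show "?f (Suc j) * Q ^ (m - j) * gbinom Q m j
        = Q ^ Suc m * (Q * (Q ^ (j * (j + 2)) * inv_qpoch Q (Suc j) * gbinom Q m j))"
      by (simp add: algebra_simps power_add)
  qed simp
  also have "Q * ?Y = inv_qpoch Q (Suc m) - durfee_sum Q 1 m"
    using durfee_sum_Suc[of 0 m] by (simp add: durfee_sum_0)
  finally show ?thesis by (simp add: algebra_simps)
qed

text \<open>Subtracting the sums left over when \<open>durfee_sum_Suc\<close> is applied for \<open>c = 0\<close> and \<open>c = 1\<close>
  produces the factor \<open>1 - Q\<^bsup>j+1\<^esup>\<close> in each summand, which turns \<open>r\<^bsub>j+1\<^esub>\<close> into \<open>r\<^sub>j\<close>.\<close>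

lemma durfee_sum_contiguous: "inv_qpoch Q (Suc m) - durfee_sum Q 1 (Suc m) = durfee_sum Q 1 m - (1 - Q) * durfee_sum Q 2 m"
proof -
  let ?Y = "\<lambda>c. \<Sum>j\<le>m. Q ^ (j * (j + c)) * inv_qpoch Q (Suc j) * gbinom Q m j"
  have Y: "?Y 2 - Q * ?Y 3 = durfee_sum Q 2 m"
    unfolding durfee_sum_def sum_distrib_left sum_subtractf [symmetric]
  proof (rule sum.cong)
    fix j
    show "Q ^ (j * (j + 2)) * inv_qpoch Q (Suc j) * gbinom Q m j
          - Q * (Q ^ (j * (j + 3)) * inv_qpoch Q (Suc j) * gbinom Q m j)
        = Q ^ (j * (j + 2)) * inv_qpoch Q j * gbinom Q m j"
      unfolding inv_qpoch_rec[of j] by (simp add: power_add algebra_simps numeral_eq_Suc)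
  qed simp
  have 0: "inv_qpoch Q (Suc m) = durfee_sum Q 1 m + Q * ?Y 2"
    using durfee_sum_Suc[of 0 m] by (simp add: durfee_sum_0)
  have 1: "durfee_sum Q 1 (Suc m) = durfee_sum Q 2 m + Q * Q * ?Y 3"
    using durfee_sum_Suc[of 1 m] by (simp add: numeral_eq_Suc)
  have "inv_qpoch Q (Suc m) - durfee_sum Q 1 (Suc m) = durfee_sum Q 1 m - durfee_sum Q 2 m + Q * (?Y 2 - Q * ?Y 3)"
    unfolding 0 1 by (simp only: algebra_simps)
  then show ?thesis unfolding Y by (simp add: algebra_simps)
qed

lemma partial_theta_coeff_shift:
  "(\<Sum>i\<le>m. (-1) ^ i * Q ^ (Suc (Suc i) choose 2) * inv_qpoch Q (m - i))
    = inv_qpoch Q (Suc m) - partial_theta_coeff Q (Suc m)"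
  unfolding partial_theta_coeff_def sum.atMost_Suc_shift by (simp add: sum_negf numeral_2_eq_2)

text \<open>Writing \<open>r\<^bsub>m-i\<^esub> = (1 - Q\<^bsup>m+1-i\<^esup>) r\<^bsub>m+1-i\<^esub>\<close> splits the defining sum; in the second part the
  factor \<open>Q\<^bsup>-i\<^esup>\<close> lowers the exponent \<open>i(i+1)/2\<close> to \<open>i(i-1)/2\<close>, so that a shift of index gives the
  partial theta coefficient back.\<close>

lemma partial_theta_coeff_rec: "partial_theta_coeff Q (Suc m) = (1 - Q ^ Suc m) * partial_theta_coeff Q m + Q ^ Suc m * inv_qpoch Q (Suc m)"
proof -
  let ?g = "\<lambda>e i. (-1) ^ i * Q ^ e i * inv_qpoch Q (Suc m - i)"
  have "partial_theta_coeff Q m = (\<Sum>i\<le>m. (-1) ^ i * Q ^ (Suc i choose 2) * ((1 - Q ^ Suc (m - i)) * inv_qpoch Q (Suc (m - i))))"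
    unfolding partial_theta_coeff_def inv_qpoch_rec [symmetric] ..
  also have "\<dots> = (\<Sum>i\<le>m. ?g (\<lambda>i. Suc i choose 2) i - Q ^ Suc m * ?g (\<lambda>i. i choose 2) i)"
  proof (rule sum.cong)
    fix i assume "i \<in> {..m}"
    then obtain a where "m = i + a" using le_Suc_ex by auto
    then show "(-1) ^ i * Q ^ (Suc i choose 2) * ((1 - Q ^ Suc (m - i)) * inv_qpoch Q (Suc (m - i)))
        = ?g (\<lambda>i. Suc i choose 2) i - Q ^ Suc m * ?g (\<lambda>i. i choose 2) i"
      by (simp add: numeral_2_eq_2 algebra_simps power_add)
  qed simp
  also have "\<dots> = (\<Sum>i\<le>Suc m. ?g (\<lambda>i. Suc i choose 2) i - Q ^ Suc m * ?g (\<lambda>i. i choose 2) i)"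
    by (simp add: numeral_2_eq_2 algebra_simps power_add)
  also have "\<dots> = partial_theta_coeff Q (Suc m) - Q ^ Suc m * (\<Sum>i\<le>Suc m. ?g (\<lambda>i. i choose 2) i)"
    unfolding partial_theta_coeff_def sum_subtractf sum_distrib_left ..
  also have "(\<Sum>i\<le>Suc m. ?g (\<lambda>i. i choose 2) i) = inv_qpoch Q (Suc m) - partial_theta_coeff Q m"
    unfolding partial_theta_coeff_def sum.atMost_Suc_shift by (simp add: sum_negf numeral_2_eq_2)
  finally show ?thesis by (simp add: algebra_simps)
qed

lemma durfee_sum_1_eq_partial_theta_coeff: "durfee_sum Q 1 m = partial_theta_coeff Q m"
proof (induction m)
  case 0
  show ?case by (simp add: durfee_sum_def partial_theta_coeff_def numeral_2_eq_2)
next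
  case (Suc m)
  then show ?case by (simp only: durfee_sum_1_rec partial_theta_coeff_rec)
qed

text \<open>As \<open>Q = t\<^sup>2\<close>, the left-hand side is
  \<open>D\<^sub>1 + t (D\<^sub>1 - (1 - Q) D\<^sub>2)\<close>.  Its two terms are the two halves of the factor \<open>1 + t Q\<^bsup>i+1\<^esup>\<close>, by
  \<open>durfee_sum_1_eq_partial_theta_coeff\<close> and \<open>durfee_sum_contiguous\<close>.\<close>

lemma durfee_sums_eq_partial_theta:
  assumes t: "t\<^sup>2 = Q"
  shows "(1 + t) * (durfee_sum Q 1 m + (Q - t) * durfee_sum Q 2 m)
    = (\<Sum>i\<le>m. (-1) ^ i * Q ^ (Suc i choose 2) * (1 + t * Q ^ Suc i) * inv_qpoch Q (m - i))"
proof -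
  have "(\<Sum>i\<le>m. (-1) ^ i * Q ^ (Suc i choose 2) * (1 + t * Q ^ Suc i) * inv_qpoch Q (m - i))
      = partial_theta_coeff Q m + t * (\<Sum>i\<le>m. (-1) ^ i * Q ^ (Suc (Suc i) choose 2) * inv_qpoch Q (m - i))"
    unfolding partial_theta_coeff_def sum_distrib_left sum.distrib [symmetric]
    by (rule sum.cong) (simp_all add: numeral_2_eq_2 power_add algebra_simps)
  also have "\<dots> = durfee_sum Q 1 m + t * (durfee_sum Q 1 m - (1 - Q) * durfee_sum Q 2 m)"
    unfolding partial_theta_coeff_shift durfee_sum_1_eq_partial_theta_coeff [symmetric] durfee_sum_contiguous ..
  also have "\<dots> = (1 + t) * (durfee_sum Q 1 m + (Q - t) * durfee_sum Q 2 m)"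
    unfolding t [symmetric] by (simp add: algebra_simps power2_eq_square)
  finally show ?thesis ..
qed

end

section \<open>Adding and deleting the first column\<close>

text \<open>Prepends a column of height \<open>k\<close> to the Young diagram; meaningful when \<open>size \<nu> \<le> k\<close>.\<close>

definition add_column :: "nat \<Rightarrow> nat multiset \<Rightarrow> nat multiset" where
  "add_column k \<nu> = image_mset Suc \<nu> + replicate_mset (k - size \<nu>) 1"

definition drop_column :: "nat multiset \<Rightarrow> nat multiset" where
  "drop_column \<mu> = image_mset (\<lambda>i. i - 1) (filter_mset (\<lambda>i. 1 < i) \<mu>)"

lemma count_image_Suc: "count (image_mset Suc \<nu>) (Suc i) = count \<nu> i"
  by (induction \<nu>) auto

lemma count_image_Suc_0: "count (image_mset Suc \<nu>) 0 = 0"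
  by (induction \<nu>) auto

lemma count_add_column:
  "count (add_column k \<nu>) 0 = 0"
  "0 \<notin># \<nu> \<Longrightarrow> count (add_column k \<nu>) 1 = k - size \<nu>"
  "1 \<le> i \<Longrightarrow> count (add_column k \<nu>) (Suc i) = count \<nu> i"
  unfolding add_column_def
  using count_image_Suc[of \<nu> 0]
  by (auto simp: count_image_Suc count_image_Suc_0 not_in_iff)

lemma size_add_column: "size \<nu> \<le> k \<Longrightarrow> size (add_column k \<nu>) = k"
  by (simp add: add_column_def)

lemma sum_image_Suc: "sum_mset (image_mset Suc \<nu>) = sum_mset \<nu> + size \<nu>"
  by (induction \<nu>) auto

lemma sum_add_column: "size \<nu> \<le> k \<Longrightarrow> sum_mset (add_column k \<nu>) = sum_mset \<nu> + k"
  by (simp add: add_column_def sum_image_Suc)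

lemma size_le_sum_mset: "0 \<notin># \<mu> \<Longrightarrow> size \<mu> \<le> sum_mset (\<mu> :: nat multiset)"
  by (induction \<mu>) auto

lemma drop_add_column:
  assumes "0 \<notin># \<nu>"
  shows "drop_column (add_column k \<nu>) = \<nu>"
proof -
  have "filter_mset (\<lambda>i. 0 < i) \<nu> = \<nu>"
    using assms by (auto simp: filter_mset_eq_conv intro!: gr0I)
  moreover have "filter_mset (\<lambda>i. Suc 0 < i) (replicate_mset c (Suc 0)) = {#}" for c
    by (induction c) auto
  ultimately show ?thesis
    by (simp add: drop_column_def add_column_def filter_mset_image_mset image_mset.compositionality o_def)
qed

lemma add_drop_column:
  assumes "0 \<notin># \<mu>"
  shows "add_column (size \<mu>) (drop_column \<mu>) = \<mu>"
proof -
  let ?A = "filter_mset (\<lambda>i. 1 < i) \<mu>"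
  have "filter_mset (\<lambda>i. \<not> 1 < i) \<mu> = filter_mset (\<lambda>i. i = 1) \<mu>"
    using assms by (intro filter_mset_cong refl) (metis less_one linorder_neqE_nat)
  also have "\<dots> = replicate_mset (count \<mu> 1) 1"
    by (simp add: filter_eq_replicate_mset)
  finally have split: "\<mu> = ?A + replicate_mset (count \<mu> 1) 1"
    using multiset_partition[of \<mu> "\<lambda>i. 1 < i"] by simp
  then have "size \<mu> = size ?A + count \<mu> 1"
    by (metis size_union size_replicate_mset)
  moreover have "image_mset Suc (image_mset (\<lambda>i. i - 1) ?A) = ?A"
    unfolding image_mset.compositionality by (subst multiset.map_cong0[where g=id]) auto
  ultimately show ?thesis
    using split by (simp add: add_column_def drop_column_def)
qed

lemma size_drop_column: "size (drop_column \<mu>) \<le> size \<mu>"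
  by (simp add: drop_column_def size_filter_mset_lesseq)

lemma bij_add_column:
  assumes "k \<le> n"
  shows "bij_betw (add_column k) {\<nu> \<in> partitions_of (n - k). size \<nu> \<le> k}
           {\<mu> \<in> partitions_of n. size \<mu> = k}"
proof (rule bij_betw_byWitness[where f' = drop_column])
  show "\<forall>\<nu>\<in>{\<nu> \<in> partitions_of (n - k). size \<nu> \<le> k}. drop_column (add_column k \<nu>) = \<nu>"
    by (auto simp: partitions_of_def drop_add_column)
  show "\<forall>\<mu>\<in>{\<mu> \<in> partitions_of n. size \<mu> = k}. add_column k (drop_column \<mu>) = \<mu>"
    by (auto simp: partitions_of_def add_drop_column)
  show "add_column k ` {\<nu> \<in> partitions_of (n - k). size \<nu> \<le> k} \<subseteq> {\<mu> \<in> partitions_of n. size \<mu> = k}"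
    using assms count_add_column(1)[of k]
    by (auto simp: partitions_of_def size_add_column sum_add_column count_eq_zero_iff)
  show "drop_column ` {\<mu> \<in> partitions_of n. size \<mu> = k} \<subseteq> {\<nu> \<in> partitions_of (n - k). size \<nu> \<le> k}"
  proof safe
    fix \<mu> :: "nat multiset" assume \<mu>: "\<mu> \<in> partitions_of n" "k = size \<mu>"
    then have nz: "0 \<notin># \<mu>" and n: "sum_mset \<mu> = n" by (auto simp: partitions_of_def)
    have "sum_mset (drop_column \<mu>) + size \<mu> = n"
      using sum_add_column[OF size_drop_column[of \<mu>]] add_drop_column[OF nz] n by simp
    then show "drop_column \<mu> \<in> partitions_of (n - size \<mu>)"
      by (auto simp: partitions_of_def drop_column_def)
    show "size (drop_column \<mu>) \<le> size \<mu>" by (rule size_drop_column)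
  qed
qed

lemma conj_part_1: "0 \<notin># \<mu> \<Longrightarrow> conj_part \<mu> 1 = size \<mu>"
proof -
  assume "0 \<notin># \<mu>"
  then have "filter_mset (\<lambda>j. 1 \<le> j) \<mu> = \<mu>"
    by (auto simp: filter_mset_eq_conv Suc_le_eq intro!: gr0I)
  then show ?thesis by (simp add: conj_part_eq_size)
qed

lemma conj_part_add_column:
  "1 \<le> i \<Longrightarrow> conj_part (add_column k \<nu>) (Suc i) = conj_part \<nu> i"
proof -
  assume "1 \<le> i"
  then have "filter_mset (\<lambda>j. Suc i \<le> j) (add_column k \<nu>) = image_mset Suc (filter_mset (\<lambda>j. i \<le> j) \<nu>)"
    by (simp add: add_column_def filter_mset_image_mset)
  then show ?thesis
    by (simp add: conj_part_eq_size)
qed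

lemma conj_sum_squares_eq:
  "sum_mset \<mu> \<le> N \<Longrightarrow> conj_sum_squares \<mu> = (\<Sum>i=1..N. (conj_part \<mu> i)\<^sup>2)"
  unfolding conj_sum_squares_def
  by (rule sum.mono_neutral_left) (auto simp: conj_part_eq_0_beyond_sum)

lemma conj_sum_squares_add_column:
  assumes "0 \<notin># \<nu>" "size \<nu> \<le> k" "1 \<le> k"
  shows "conj_sum_squares (add_column k \<nu>) = k\<^sup>2 + conj_sum_squares \<nu>"
proof -
  obtain N where N: "sum_mset \<nu> + k = Suc N" using assms(3) by (cases "sum_mset \<nu> + k") auto
  have nz: "0 \<notin># add_column k \<nu>" using count_add_column(1)[of k \<nu>] by (simp add: count_eq_zero_iff)
  have "conj_sum_squares (add_column k \<nu>) = (\<Sum>i=1..Suc N. (conj_part (add_column k \<nu>) i)\<^sup>2)"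
    unfolding conj_sum_squares_def using sum_add_column[OF assms(2)] N by simp
  also have "\<dots> = (conj_part (add_column k \<nu>) 1)\<^sup>2 + (\<Sum>i=1..N. (conj_part (add_column k \<nu>) (Suc i))\<^sup>2)"
    by (subst sum.atLeast_Suc_atMost) (simp_all add: sum.shift_bounds_cl_Suc_ivl del: sum.cl_ivl_Suc)
  also have "\<dots> = k\<^sup>2 + (\<Sum>i=1..N. (conj_part \<nu> i)\<^sup>2)"
    using conj_part_1[OF nz] size_add_column[OF assms(2)] by (simp add: conj_part_add_column)
  also have "(\<Sum>i=1..N. (conj_part \<nu> i)\<^sup>2) = conj_sum_squares \<nu>"
    using N assms(3) by (intro conj_sum_squares_eq [symmetric]) simp
  finally show ?thesis .
qed

lemma odd_parts_le_size: "odd_parts \<mu> \<le> size \<mu>"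
  by (simp add: odd_parts_def size_filter_mset_lesseq)

lemma odd_parts_add_column:
  assumes "size \<nu> \<le> k"
  shows "odd_parts (add_column k \<nu>) = k - odd_parts \<nu>"
proof -
  have "size (filter_mset even \<nu>) + odd_parts \<nu> = size \<nu>"
    unfolding odd_parts_def by (metis multiset_partition size_union)
  moreover have "filter_mset odd (replicate_mset c (Suc 0)) = replicate_mset c (Suc 0)" for c
    by (induction c) auto
  ultimately show ?thesis
    using assms by (simp add: odd_parts_def add_column_def filter_mset_image_mset)
qed

text \<open>Guards the truncated subtraction in the exponent of the companion weight.\<close>

lemma odd_parts_le_conj_sum_squares:
  assumes "0 \<notin># \<mu>"
  shows "odd_parts \<mu> \<le> conj_sum_squares \<mu>"
proof (cases "sum_mset \<mu> = 0")
  case True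
  then show ?thesis
    using odd_parts_le_size[of \<mu>] size_le_sum_mset[OF assms] by linarith
next
  case False
  have "odd_parts \<mu> \<le> size \<mu>" by (rule odd_parts_le_size)
  also have "\<dots> \<le> (conj_part \<mu> 1)\<^sup>2"
    unfolding conj_part_1[OF assms] by (simp add: power2_eq_square)
  also have "\<dots> \<le> conj_sum_squares \<mu>"
  proof -
    have "1 \<in> {1..sum_mset \<mu>}"
      using False by (metis One_nat_def Suc_leI atLeastAtMost_iff gr0I le_refl)
    then show ?thesis
      unfolding conj_sum_squares_def by (intro member_le_sum) auto
  qed
  finally show ?thesis .
qed

section \<open>Weights under adding a column\<close>

definition sp_weight :: "'a::field \<Rightarrow> nat multiset \<Rightarrow> 'a" where
  "sp_weight t \<mu> = t ^ ((conj_sum_squares \<mu> + odd_parts \<mu>) div 2)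
     * (\<Prod>i=1..sum_mset \<mu>. inv_qpoch (t\<^sup>2) (count \<mu> i div 2))"

definition orth_weight :: "'a::field \<Rightarrow> nat multiset \<Rightarrow> 'a" where
  "orth_weight t \<mu> = t ^ ((conj_sum_squares \<mu> - odd_parts \<mu>) div 2)
     * (\<Prod>i=1..sum_mset \<mu>. inv_qpoch (t\<^sup>2) (count \<mu> i div 2))"

lemma prod_inv_qpoch_add_column:
  assumes "0 \<notin># \<nu>" "size \<nu> \<le> k" "1 \<le> k"
  shows "(\<Prod>i=1..sum_mset (add_column k \<nu>). inv_qpoch Q (count (add_column k \<nu>) i div 2))
    = inv_qpoch Q ((k - size \<nu>) div 2) * (\<Prod>i=1..sum_mset \<nu>. inv_qpoch Q (count \<nu> i div 2))"
proof -
  let ?f = "\<lambda>i. inv_qpoch Q (count (add_column k \<nu>) i div 2)"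
  obtain N where N: "sum_mset \<nu> + k = Suc N" using assms(3) by (cases "sum_mset \<nu> + k") auto
  have "prod ?f {1..sum_mset (add_column k \<nu>)} = prod ?f {1..Suc N}"
    using sum_add_column[OF assms(2)] N by simp
  also have "\<dots> = ?f 1 * (\<Prod>i=1..N. ?f (Suc i))"
    by (subst prod.atLeast_Suc_atMost) (simp_all add: prod.shift_bounds_cl_Suc_ivl del: prod.cl_ivl_Suc)
  also have "\<dots> = inv_qpoch Q ((k - size \<nu>) div 2) * (\<Prod>i=1..N. inv_qpoch Q (count \<nu> i div 2))"
    using count_add_column(2)[OF assms(1)] by (simp add: count_add_column(3))
  also have "(\<Prod>i=1..N. inv_qpoch Q (count \<nu> i div 2)) = (\<Prod>i=1..sum_mset \<nu>. inv_qpoch Q (count \<nu> i div 2))"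
    using N assms(3)
    by (intro prod.mono_neutral_right) (auto simp: count_eq_0_beyond_sum)
  finally show ?thesis .
qed

text \<open>The parts of the enlarged partition that are odd are those that were even, together with the new
  parts \<open>1\<close>; this is what exchanges the two weights.\<close>

lemma sp_weight_add_column:
  assumes "0 \<notin># \<nu>" "size \<nu> \<le> k" "1 \<le> k"
  shows "sp_weight t (add_column k \<nu>)
    = t ^ (k * (k + 1) div 2) * inv_qpoch (t\<^sup>2) ((k - size \<nu>) div 2) * orth_weight t \<nu>"
proof -
  have "conj_sum_squares (add_column k \<nu>) + odd_parts (add_column k \<nu>)
      = k * (k + 1) + (conj_sum_squares \<nu> - odd_parts \<nu>)"
    using conj_sum_squares_add_column[OF assms] odd_parts_add_column[OF assms(2)]
      odd_parts_le_conj_sum_squares[OF assms(1)] odd_parts_le_size[of \<nu>] assms(2)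
    by (simp add: power2_eq_square)
  moreover have "even (k * (k + 1))" by simp
  ultimately have "(conj_sum_squares (add_column k \<nu>) + odd_parts (add_column k \<nu>)) div 2
      = k * (k + 1) div 2 + (conj_sum_squares \<nu> - odd_parts \<nu>) div 2"
    by (metis div_plus_div_distrib_dvd_left)
  then show ?thesis
    unfolding sp_weight_def orth_weight_def prod_inv_qpoch_add_column[OF assms]
    by (simp add: power_add)
qed

lemma orth_weight_add_column:
  assumes "0 \<notin># \<nu>" "size \<nu> \<le> k" "1 \<le> k"
  shows "orth_weight t (add_column k \<nu>)
    = t ^ (k * (k - 1) div 2) * inv_qpoch (t\<^sup>2) ((k - size \<nu>) div 2) * sp_weight t \<nu>"
proof -
  have "k \<le> k\<^sup>2" by (simp add: power2_eq_square)
  then have "conj_sum_squares (add_column k \<nu>) - odd_parts (add_column k \<nu>)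
      = k * (k - 1) + (conj_sum_squares \<nu> + odd_parts \<nu>)"
    using conj_sum_squares_add_column[OF assms] odd_parts_add_column[OF assms(2)]
      odd_parts_le_size[of \<nu>] assms(2)
    by (simp add: power2_eq_square diff_mult_distrib2)
  moreover have "even (k * (k - 1))" by auto
  ultimately have "(conj_sum_squares (add_column k \<nu>) - odd_parts (add_column k \<nu>)) div 2
      = k * (k - 1) div 2 + (conj_sum_squares \<nu> + odd_parts \<nu>) div 2"
    by (metis div_plus_div_distrib_dvd_left)
  then show ?thesis
    unfolding sp_weight_def orth_weight_def prod_inv_qpoch_add_column[OF assms]
    by (simp add: power_add)
qed

text \<open>The parity condition is a parameter because adding a column shifts it: \<open>P = odd\<close> is the
  symplectic and \<open>P = even\<close> the orthogonal case.\<close>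

definition paired_partitions :: "(nat \<Rightarrow> bool) \<Rightarrow> nat \<Rightarrow> nat \<Rightarrow> nat multiset set" where
  "paired_partitions P k n = {\<mu> \<in> partitions_of n. size \<mu> = k \<and> (\<forall>i. P i \<longrightarrow> even (count \<mu> i))}"

text \<open>The new multiplicity of \<open>1\<close> is \<open>k - l\<close>, where \<open>l\<close> is the number of parts of the smaller
  partition; it is the only multiplicity not already present there.\<close>

lemma sum_paired_partitions_rec:
  fixes w :: "nat multiset \<Rightarrow> 'a::comm_monoid_add"
  assumes "k \<le> n" and P': "\<And>i. 1 \<le> i \<Longrightarrow> P' i \<longleftrightarrow> P (Suc i)"
  shows "sum w (paired_partitions P k n)
    = (\<Sum>l\<le>k. if P 1 \<and> odd (k - l) then 0
        else \<Sum>\<nu>\<in>paired_partitions P' l (n - k). w (add_column k \<nu>))"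
proof -
  let ?D = "{\<nu> \<in> partitions_of (n - k). size \<nu> \<le> k}"
  let ?C = "\<lambda>P \<mu>. \<forall>i. P i \<longrightarrow> even (count \<mu> i)"
  have cond: "?C P (add_column k \<nu>) \<longleftrightarrow> (P 1 \<longrightarrow> even (k - size \<nu>)) \<and> ?C P' \<nu>"
    if "0 \<notin># \<nu>" for \<nu>
  proof -
    have "?C P (add_column k \<nu>) \<longleftrightarrow> (P 1 \<longrightarrow> even (k - size \<nu>)) \<and> (\<forall>i\<ge>1. P (Suc i) \<longrightarrow> even (count \<nu> i))"
      (is "?l = ?r")
    proof
      assume ?l
      then show ?r
        using count_add_column(2)[OF that, of k] count_add_column(3)[of _ k \<nu>] by metis
    next
      assume r: ?r
      show ?l
      proof (intro allI impI)
        fix i assume "P i"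
        then consider "i = 0" | "i = 1" | j where "i = Suc j" "1 \<le> j"
          by (metis One_nat_def Suc_leI not0_implies_Suc not_gr_zero)
        then show "even (count (add_column k \<nu>) i)"
          using r \<open>P i\<close> count_add_column(1)[of k \<nu>] count_add_column(2)[of \<nu> k] count_add_column(3)[of _ k \<nu>] that by cases auto
      qed
    qed
    moreover have "(\<forall>i\<ge>1. P (Suc i) \<longrightarrow> even (count \<nu> i)) \<longleftrightarrow> ?C P' \<nu>"
      using P' that by (metis count_eq_zero_iff even_zero less_one linorder_not_less)
    ultimately show ?thesis by simp
  qed
  have "sum w (paired_partitions P k n)
      = (\<Sum>\<mu>\<in>{\<mu> \<in> partitions_of n. size \<mu> = k}. if ?C P \<mu> then w \<mu> else 0)"
    unfolding paired_partitions_def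
    by (subst sum.inter_filter [symmetric]) (auto simp: finite_partitions_of intro!: sum.cong)
  also have "\<dots> = (\<Sum>\<nu>\<in>?D. if ?C P (add_column k \<nu>) then w (add_column k \<nu>) else 0)"
    by (rule sum.reindex_bij_betw [OF bij_add_column [OF assms(1)], symmetric])
  also have "\<dots> = (\<Sum>\<nu>\<in>?D. if (P 1 \<longrightarrow> even (k - size \<nu>)) \<and> ?C P' \<nu> then w (add_column k \<nu>) else 0)"
    using cond by (intro sum.cong) (auto simp: partitions_of_def)
  also have "\<dots> = (\<Sum>l\<le>k. \<Sum>\<nu>\<in>{\<nu> \<in> ?D. size \<nu> = l}.
      if (P 1 \<longrightarrow> even (k - size \<nu>)) \<and> ?C P' \<nu> then w (add_column k \<nu>) else 0)"
    by (rule sum.group [symmetric]) (auto simp: finite_partitions_of)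
  also have "\<dots> = (\<Sum>l\<le>k. if P 1 \<and> odd (k - l) then 0
        else \<Sum>\<nu>\<in>paired_partitions P' l (n - k). w (add_column k \<nu>))"
  proof (rule sum.cong)
    fix l assume l: "l \<in> {..k}"
    have "paired_partitions P' l (n - k) = {\<nu> \<in> {\<nu> \<in> ?D. size \<nu> = l}. ?C P' \<nu>}"
      using l by (auto simp: paired_partitions_def)
    then show "(\<Sum>\<nu>\<in>{\<nu> \<in> ?D. size \<nu> = l}.
        if (P 1 \<longrightarrow> even (k - size \<nu>)) \<and> ?C P' \<nu> then w (add_column k \<nu>) else 0)
      = (if P 1 \<and> odd (k - l) then 0 else \<Sum>\<nu>\<in>paired_partitions P' l (n - k). w (add_column k \<nu>))"
      by (simp only:, subst sum.inter_filter) (auto simp: finite_partitions_of intro!: sum.cong sum.neutral)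
  qed simp
  finally show ?thesis .
qed

definition sp_sum :: "'a::field \<Rightarrow> nat \<Rightarrow> nat \<Rightarrow> 'a" where
  "sp_sum t k n = sum (sp_weight t) (paired_partitions odd k n)"

definition orth_sum :: "'a::field \<Rightarrow> nat \<Rightarrow> nat \<Rightarrow> 'a" where
  "orth_sum t k n = sum (orth_weight t) (paired_partitions even k n)"

lemma sp_sum_rec:
  assumes "1 \<le> k" "k \<le> n"
  shows "sp_sum t k n = t ^ (k * (k + 1) div 2) *
    (\<Sum>l\<le>k. if odd (k - l) then 0 else inv_qpoch (t\<^sup>2) ((k - l) div 2) * orth_sum t l (n - k))"
proof -
  have "sp_sum t k n = (\<Sum>l\<le>k. if odd (k - l) then 0
        else \<Sum>\<nu>\<in>paired_partitions even l (n - k). sp_weight t (add_column k \<nu>))"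
    unfolding sp_sum_def by (subst sum_paired_partitions_rec[where P' = even]) (use assms in auto)
  also have "\<dots> = (\<Sum>l\<le>k. if odd (k - l) then 0
        else \<Sum>\<nu>\<in>paired_partitions even l (n - k).
          t ^ (k * (k + 1) div 2) * inv_qpoch (t\<^sup>2) ((k - l) div 2) * orth_weight t \<nu>)"
    using assms(1) by (intro sum.cong if_cong refl)
      (auto simp: paired_partitions_def partitions_of_def sp_weight_add_column)
  finally show ?thesis
    unfolding orth_sum_def by (simp add: sum_distrib_left mult.assoc if_distrib cong: if_cong)
qed

lemma orth_sum_rec:
  assumes "1 \<le> k" "k \<le> n"
  shows "orth_sum t k n = t ^ (k * (k - 1) div 2) *
    (\<Sum>l\<le>k. inv_qpoch (t\<^sup>2) ((k - l) div 2) * sp_sum t l (n - k))"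
proof -
  have "orth_sum t k n = (\<Sum>l\<le>k. \<Sum>\<nu>\<in>paired_partitions odd l (n - k). orth_weight t (add_column k \<nu>))"
    unfolding orth_sum_def by (subst sum_paired_partitions_rec[where P' = odd]) (use assms in auto)
  also have "\<dots> = (\<Sum>l\<le>k. \<Sum>\<nu>\<in>paired_partitions odd l (n - k).
          t ^ (k * (k - 1) div 2) * inv_qpoch (t\<^sup>2) ((k - l) div 2) * sp_weight t \<nu>)"
    using assms(1) by (intro sum.cong refl)
      (auto simp: paired_partitions_def partitions_of_def orth_weight_add_column)
  finally show ?thesis
    unfolding sp_sum_def by (simp add: sum_distrib_left mult.assoc)
qed

section \<open>Closed forms\<close>

lemma paired_partitions_0: "paired_partitions P 0 n = (if n = 0 then {{#}} else {})"
  by (auto simp: paired_partitions_def partitions_of_def)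

lemma paired_partitions_empty: "n < k \<Longrightarrow> paired_partitions P k n = {}"
  using size_le_sum_mset by (fastforce simp: paired_partitions_def partitions_of_def)

text \<open>For \<open>n > 0\<close>, the value for \<open>k = 2j\<close> and \<open>n = 2m\<close> is \<open>t\<^sup>m Q\<^bsup>j\<^sup>2\<^esup> r\<^sub>j [m-1,j-1]\<close>, the coefficient of
  \<open>w\<^sup>m\<close> in the product \<open>w\<^sup>j t\<^bsup>j(2j+1)\<^esup> / ((Q;Q)\<^sub>j (wt;Q)\<^sub>j)\<close>; the other cases come from similar products.\<close>

definition sp_closed :: "'a::field \<Rightarrow> nat \<Rightarrow> nat \<Rightarrow> 'a" where
  "sp_closed t k n = (if k = 0 \<or> n = 0 then of_bool (k = n) else if odd n then 0
     else if even k then t ^ (n div 2) * (t\<^sup>2) ^ ((k div 2) * (k div 2)) * inv_qpoch (t\<^sup>2) (k div 2)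
       * gbinom (t\<^sup>2) (n div 2 - 1) (k div 2 - 1)
     else t ^ (n div 2) * (t\<^sup>2) ^ ((k div 2) * (k div 2 + 1)) * inv_qpoch (t\<^sup>2) (k div 2)
       * gbinom (t\<^sup>2) (n div 2 - 1) (k div 2))"

definition orth_closed :: "'a::field \<Rightarrow> nat \<Rightarrow> nat \<Rightarrow> 'a" where
  "orth_closed t k n = (if k = 0 \<or> n = 0 then of_bool (k = n) else if odd (k + n) then 0
     else if even k then t ^ (n div 2) * (t\<^sup>2) ^ ((k div 2 - 1) * (k div 2)) * inv_qpoch (t\<^sup>2) (k div 2)
       * gbinom (t\<^sup>2) (n div 2 - 1) (k div 2 - 1)
     else t ^ (n div 2) * (t\<^sup>2) ^ ((k div 2) * (k div 2)) * inv_qpoch (t\<^sup>2) (k div 2)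
       * gbinom (t\<^sup>2) (n div 2) (k div 2))"

lemma sp_closed_simps:
  "sp_closed t 0 n = of_bool (n = 0)"
  "sp_closed t k 0 = of_bool (k = 0)"
  "odd n \<Longrightarrow> sp_closed t k n = 0"
  "sp_closed t (2 * Suc j) (2 * Suc m)
     = t ^ Suc m * (t\<^sup>2) ^ (Suc j * Suc j) * inv_qpoch (t\<^sup>2) (Suc j) * gbinom (t\<^sup>2) m j"
  "sp_closed t (2 * j + 1) (2 * Suc m)
     = t ^ Suc m * (t\<^sup>2) ^ (j * (j + 1)) * inv_qpoch (t\<^sup>2) j * gbinom (t\<^sup>2) m j"
  by (auto simp: sp_closed_def elim: oddE)

lemma orth_closed_simps:
  "orth_closed t 0 n = of_bool (n = 0)"
  "orth_closed t k 0 = of_bool (k = 0)"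
  "odd (k + n) \<Longrightarrow> orth_closed t k n = 0"
  "orth_closed t (2 * Suc j) (2 * Suc m)
     = t ^ Suc m * (t\<^sup>2) ^ (j * (j + 1)) * inv_qpoch (t\<^sup>2) (Suc j) * gbinom (t\<^sup>2) m j"
  "orth_closed t (2 * j + 1) (2 * m + 1)
     = t ^ m * (t\<^sup>2) ^ (j * j) * inv_qpoch (t\<^sup>2) j * gbinom (t\<^sup>2) m j"
  by (auto simp: orth_closed_def elim: oddE)

lemma sum_even_odd:
  fixes f :: "nat \<Rightarrow> 'a::comm_monoid_add"
  shows "(\<Sum>l\<le>2 * k + 1. f l) = (\<Sum>j\<le>k. f (2 * j)) + (\<Sum>j\<le>k. f (2 * j + 1))"
  by (induction k) (simp_all add: ac_simps)

lemma sum_even_odd':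
  fixes f :: "nat \<Rightarrow> 'a::comm_monoid_add"
  shows "(\<Sum>l\<le>2 * Suc k. f l) = (\<Sum>j\<le>Suc k. f (2 * j)) + (\<Sum>j\<le>k. f (2 * j + 1))"
  using sum_even_odd[of f k] by (simp add: ac_simps)

context
  fixes t :: "'a::field"
  assumes generic: "\<And>k. (t\<^sup>2) ^ Suc k \<noteq> 1"
begin

text \<open>Combining the partitions into \<open>2j\<close> and into \<open>2j + 1\<close> parts is possible because they enter the recurrence
  for odd \<open>k\<close> with the same factor; the two closed forms then merge by a Pascal rule.\<close>

lemma sp_closed_pair:
  "sp_closed t (2 * j) (2 * b) + sp_closed t (2 * j + 1) (2 * b) = t ^ b * (t\<^sup>2) ^ (j * j) * inv_qpoch (t\<^sup>2) j * gbinom (t\<^sup>2) b j"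
proof (cases b)
  case 0
  then show ?thesis by (cases j) (simp_all add: sp_closed_simps)
next
  case (Suc b')
  show ?thesis
  proof (cases j)
    case 0
    then show ?thesis
      unfolding Suc sp_closed_simps using sp_closed_simps(1)[of t "2 * Suc b'"] by simp
  next
    case (Suc j')
    show ?thesis
      unfolding \<open>b = Suc b'\<close> Suc sp_closed_simps by (simp add: algebra_simps power_add)
  qed
qed

lemma orth_closed_conv_even:
  "(\<Sum>j\<le>Suc a. inv_qpoch (t\<^sup>2) (Suc a - j) * orth_closed t (2 * j) (2 * b)) = t ^ b * inv_qpoch (t\<^sup>2) (Suc a) * gbinom (t\<^sup>2) (a + b) a"
proof (cases b)
  case 0
  have "(\<Sum>j\<le>Suc a. inv_qpoch (t\<^sup>2) (Suc a - j) * orth_closed t (2 * j) 0) = inv_qpoch (t\<^sup>2) (Suc a)"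
    unfolding sum.atMost_Suc_shift by (simp add: orth_closed_simps)
  then show ?thesis using 0 by simp
next
  case (Suc b')
  have "(\<Sum>j\<le>Suc a. inv_qpoch (t\<^sup>2) (Suc a - j) * orth_closed t (2 * j) (2 * b))
      = (\<Sum>j\<le>a. inv_qpoch (t\<^sup>2) (a - j) * orth_closed t (2 * Suc j) (2 * Suc b'))"
    unfolding sum.atMost_Suc_shift Suc by (simp add: orth_closed_simps(1))
  also have "\<dots> = t ^ b * (\<Sum>j\<le>a. (t\<^sup>2) ^ (j * (j + 1)) * inv_qpoch (t\<^sup>2) (j + 1) * inv_qpoch (t\<^sup>2) (a - j) * gbinom (t\<^sup>2) b' j)"
    unfolding orth_closed_simps sum_distrib_left Suc by (simp add: ac_simps)
  also have "\<dots> = t ^ b * inv_qpoch (t\<^sup>2) (Suc a) * gbinom (t\<^sup>2) (a + b) a"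
    unfolding q_vandermonde[OF generic] using Suc by simp
  finally show ?thesis .
qed

lemma orth_closed_conv_odd:
  "(\<Sum>j\<le>a. inv_qpoch (t\<^sup>2) (a - j) * orth_closed t (2 * j + 1) (2 * b + 1)) = t ^ b * inv_qpoch (t\<^sup>2) a * gbinom (t\<^sup>2) (a + b) a"
proof -
  have "(\<Sum>j\<le>a. inv_qpoch (t\<^sup>2) (a - j) * orth_closed t (2 * j + 1) (2 * b + 1))
      = t ^ b * (\<Sum>j\<le>a. (t\<^sup>2) ^ (j * (j + 0)) * inv_qpoch (t\<^sup>2) (j + 0) * inv_qpoch (t\<^sup>2) (a - j) * gbinom (t\<^sup>2) b j)"
    unfolding orth_closed_simps sum_distrib_left by (simp add: ac_simps)
  then show ?thesis unfolding q_vandermonde[OF generic] by simp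
qed

lemma sp_closed_conv_odd:
  "(\<Sum>j\<le>a. inv_qpoch (t\<^sup>2) (a - j) * (sp_closed t (2 * j) (2 * b) + sp_closed t (2 * j + 1) (2 * b)))
    = t ^ b * inv_qpoch (t\<^sup>2) a * gbinom (t\<^sup>2) (a + b) a"
proof -
  have "(\<Sum>j\<le>a. inv_qpoch (t\<^sup>2) (a - j) * (sp_closed t (2 * j) (2 * b) + sp_closed t (2 * j + 1) (2 * b)))
      = t ^ b * (\<Sum>j\<le>a. (t\<^sup>2) ^ (j * (j + 0)) * inv_qpoch (t\<^sup>2) (j + 0) * inv_qpoch (t\<^sup>2) (a - j) * gbinom (t\<^sup>2) b j)"
    unfolding sp_closed_pair sum_distrib_left by (simp add: ac_simps)
  then show ?thesis unfolding q_vandermonde[OF generic] by simp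
qed

text \<open>The terms for \<open>2j + 2\<close> and \<open>2j + 1\<close> combine through \<open>Q\<^bsup>j+1\<^esup> r\<^bsub>j+1\<^esub> + r\<^sub>j = r\<^bsub>j+1\<^esub>\<close>, which leaves
  \<open>q_vandermonde\<close> with shift \<open>1\<close>.\<close>

lemma sp_closed_conv_even:
  "(\<Sum>j\<le>Suc a. inv_qpoch (t\<^sup>2) (Suc a - j) * sp_closed t (2 * j) (2 * b))
     + (\<Sum>j\<le>a. inv_qpoch (t\<^sup>2) (a - j) * sp_closed t (2 * j + 1) (2 * b))
    = t ^ b * inv_qpoch (t\<^sup>2) (Suc a) * gbinom (t\<^sup>2) (a + b) a"
proof (cases b)
  case 0
  have "(\<Sum>j\<le>Suc a. inv_qpoch (t\<^sup>2) (Suc a - j) * sp_closed t (2 * j) 0) = inv_qpoch (t\<^sup>2) (Suc a)"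
    unfolding sum.atMost_Suc_shift by (simp add: sp_closed_simps)
  then show ?thesis using 0 by (simp add: sp_closed_simps)
next
  case (Suc b')
  have "(\<Sum>j\<le>Suc a. inv_qpoch (t\<^sup>2) (Suc a - j) * sp_closed t (2 * j) (2 * b))
      = (\<Sum>j\<le>a. inv_qpoch (t\<^sup>2) (a - j) * sp_closed t (2 * Suc j) (2 * Suc b'))"
    unfolding sum.atMost_Suc_shift Suc by (simp add: sp_closed_simps(1))
  then have "(\<Sum>j\<le>Suc a. inv_qpoch (t\<^sup>2) (Suc a - j) * sp_closed t (2 * j) (2 * b))
        + (\<Sum>j\<le>a. inv_qpoch (t\<^sup>2) (a - j) * sp_closed t (2 * j + 1) (2 * b))
      = (\<Sum>j\<le>a. inv_qpoch (t\<^sup>2) (a - j) * (sp_closed t (2 * Suc j) (2 * Suc b') + sp_closed t (2 * j + 1) (2 * Suc b')))"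
    unfolding Suc by (simp add: sum.distrib distrib_left)
  also have "\<dots> = t ^ b * (\<Sum>j\<le>a. (t\<^sup>2) ^ (j * (j + 1)) * inv_qpoch (t\<^sup>2) (j + 1) * inv_qpoch (t\<^sup>2) (a - j) * gbinom (t\<^sup>2) b' j)"
    unfolding sum_distrib_left
  proof (rule sum.cong)
    fix j
    show "inv_qpoch (t\<^sup>2) (a - j) * (sp_closed t (2 * Suc j) (2 * Suc b') + sp_closed t (2 * j + 1) (2 * Suc b'))
        = t ^ b * ((t\<^sup>2) ^ (j * (j + 1)) * inv_qpoch (t\<^sup>2) (j + 1) * inv_qpoch (t\<^sup>2) (a - j) * gbinom (t\<^sup>2) b' j)"
      unfolding sp_closed_simps Suc inv_qpoch_rec[OF generic, of j]
      by (simp add: algebra_simps power_add)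
  qed simp
  also have "\<dots> = t ^ b * inv_qpoch (t\<^sup>2) (Suc a) * gbinom (t\<^sup>2) (a + b) a"
    unfolding q_vandermonde[OF generic] using Suc by simp
  finally show ?thesis .
qed

text \<open>Only \<open>l\<close> of the same parity as \<open>k\<close> contribute, and for those \<open>orth_closed\<close> vanishes unless the
  total size is even.\<close>

lemma sp_closed_rec:
  assumes "1 \<le> k"
  shows "sp_closed t k (N + k) = t ^ (k * (k + 1) div 2) *
    (\<Sum>l\<le>k. if odd (k - l) then 0 else inv_qpoch (t\<^sup>2) ((k - l) div 2) * orth_closed t l N)"
proof (cases "even (N + k)")
  case False
  have "(if odd (k - l) then 0 else inv_qpoch (t\<^sup>2) ((k - l) div 2) * orth_closed t l N) = 0" if "l \<le> k" for l
    using that False orth_closed_simps(3)[of l N t] by auto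
  then show ?thesis using False by (simp add: sp_closed_simps)
next
  case even: True
  show ?thesis
  proof (cases "even k")
    case True
    then obtain a where k: "k = 2 * Suc a" using assms by (metis dvdE mult_0_right not0_implies_Suc not_one_le_zero)
    obtain b where N: "N = 2 * b" using True even by auto
    have "(\<Sum>l\<le>k. if odd (k - l) then 0 else inv_qpoch (t\<^sup>2) ((k - l) div 2) * orth_closed t l N)
        = (\<Sum>j\<le>Suc a. inv_qpoch (t\<^sup>2) (Suc a - j) * orth_closed t (2 * j) (2 * b))"
    proof -
      have "(2 * Suc a - 2 * j) div 2 = Suc a - j" "even (2 * Suc a - 2 * j)" for j
        by presburger+
      moreover have "odd (2 * Suc a - (2 * j + 1))" if "j \<le> a" for j
        using that by presburger
      ultimately show ?thesis unfolding k N sum_even_odd' by simp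
    qed
    moreover have "sp_closed t k (N + k) = sp_closed t (2 * Suc a) (2 * Suc (a + b))"
      by (simp add: k N algebra_simps)
    moreover have "k * (k + 1) div 2 = Suc a * (2 * a + 3)"
    proof -
      have "k * (k + 1) = Suc a * (2 * a + 3) * 2" by (simp add: k algebra_simps)
      then show ?thesis by (metis div_mult_self_is_m zero_less_numeral)
    qed
    moreover have exponents: "t ^ Suc (a + b) * (t\<^sup>2) ^ (Suc a * Suc a) = t ^ (Suc a * (2 * a + 3)) * t ^ b"
      unfolding power_mult [symmetric] power_add [symmetric]
      by (rule arg_cong2[where f = power]) (simp_all add: algebra_simps)
    ultimately show ?thesis
      unfolding orth_closed_conv_even sp_closed_simps
      by (simp only: exponents orth_closed_conv_even sp_closed_simps mult.assoc [symmetric])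
  next
    case False
    then obtain a where k: "k = 2 * a + 1" by (elim oddE)
    obtain b where N: "N = 2 * b + 1" using False even by (metis even_add oddE)
    have "(\<Sum>l\<le>k. if odd (k - l) then 0 else inv_qpoch (t\<^sup>2) ((k - l) div 2) * orth_closed t l N)
        = (\<Sum>j\<le>a. inv_qpoch (t\<^sup>2) (a - j) * orth_closed t (2 * j + 1) (2 * b + 1))"
      unfolding k N sum_even_odd by (simp add: diff_mult_distrib2 [symmetric] Suc_diff_le)
    moreover have "sp_closed t k (N + k) = sp_closed t (2 * a + 1) (2 * Suc (a + b))"
      by (simp add: k N algebra_simps)
    moreover have "k * (k + 1) div 2 = (2 * a + 1) * (a + 1)" by (simp add: k)
    moreover have exponents: "t ^ Suc (a + b) * (t\<^sup>2) ^ (a * (a + 1)) = t ^ ((2 * a + 1) * (a + 1)) * t ^ b"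
      unfolding power_mult [symmetric] power_add [symmetric]
      by (rule arg_cong2[where f = power]) (simp_all add: algebra_simps)
    ultimately show ?thesis
      unfolding orth_closed_conv_odd sp_closed_simps
      by (simp only: exponents orth_closed_conv_odd sp_closed_simps mult.assoc [symmetric])
  qed
qed

lemma orth_closed_rec:
  assumes "1 \<le> k"
  shows "orth_closed t k (N + k) = t ^ (k * (k - 1) div 2) *
    (\<Sum>l\<le>k. inv_qpoch (t\<^sup>2) ((k - l) div 2) * sp_closed t l N)"
proof (cases "even N")
  case False
  then show ?thesis by (simp add: sp_closed_simps orth_closed_simps)
next
  case True
  then obtain b where N: "N = 2 * b" by auto
  show ?thesis
  proof (cases "even k")
    case True
    then obtain a where k: "k = 2 * Suc a" using assms by (metis dvdE mult_0_right not0_implies_Suc not_one_le_zero)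
    have "(\<Sum>l\<le>k. inv_qpoch (t\<^sup>2) ((k - l) div 2) * sp_closed t l N)
        = (\<Sum>j\<le>Suc a. inv_qpoch (t\<^sup>2) (Suc a - j) * sp_closed t (2 * j) (2 * b))
     + (\<Sum>j\<le>a. inv_qpoch (t\<^sup>2) (a - j) * sp_closed t (2 * j + 1) (2 * b))"
    proof -
      have "(2 * Suc a - 2 * j) div 2 = Suc a - j" "(2 * Suc a - (2 * j + 1)) div 2 = a - j" for j
        by presburger+
      then show ?thesis unfolding k N sum_even_odd' by simp
    qed
    moreover have "orth_closed t k (N + k) = orth_closed t (2 * Suc a) (2 * Suc (a + b))"
      by (simp add: k N algebra_simps)
    moreover have "k * (k - 1) div 2 = Suc a * (2 * a + 1)" by (simp add: k)
    moreover have exponents: "t ^ Suc (a + b) * (t\<^sup>2) ^ (a * (a + 1)) = t ^ (Suc a * (2 * a + 1)) * t ^ b"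
      unfolding power_mult [symmetric] power_add [symmetric]
      by (rule arg_cong2[where f = power]) (simp_all add: algebra_simps)
    ultimately show ?thesis
      unfolding sp_closed_conv_even orth_closed_simps
      by (simp only: exponents sp_closed_conv_even orth_closed_simps mult.assoc [symmetric])
  next
    case False
    then obtain a where k: "k = 2 * a + 1" by (elim oddE)
    have "(\<Sum>l\<le>k. inv_qpoch (t\<^sup>2) ((k - l) div 2) * sp_closed t l N)
        = (\<Sum>j\<le>a. inv_qpoch (t\<^sup>2) (a - j) * (sp_closed t (2 * j) (2 * b) + sp_closed t (2 * j + 1) (2 * b)))"
    proof -
      have "(2 * a + 1 - 2 * j) div 2 = a - j" "(2 * a + 1 - (2 * j + 1)) div 2 = a - j" for j
        by linarith+
      then show ?thesis unfolding k N sum_even_odd by (simp add: sum.distrib distrib_left)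
    qed
    moreover have "orth_closed t k (N + k) = orth_closed t (2 * a + 1) (2 * (a + b) + 1)"
      by (simp add: k N algebra_simps)
    moreover have "k * (k - 1) div 2 = a * (2 * a + 1)" by (simp add: k)
    moreover have exponents: "t ^ (a + b) * (t\<^sup>2) ^ (a * a) = t ^ (a * (2 * a + 1)) * t ^ b"
      unfolding power_mult [symmetric] power_add [symmetric]
      by (rule arg_cong2[where f = power]) (simp_all add: algebra_simps)
    ultimately show ?thesis
      unfolding sp_closed_conv_odd orth_closed_simps
      by (simp only: exponents sp_closed_conv_odd orth_closed_simps mult.assoc [symmetric])
  qed
qed

text \<open>For \<open>k \<ge> 1\<close> the recurrences refer to partitions of \<open>n - k < n\<close> only, so they determine both
  families.\<close>

lemma sums_eq_closed: "sp_sum t k n = sp_closed t k n \<and> orth_sum t k n = orth_closed t k n"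
proof (induction n arbitrary: k rule: less_induct)
  case (less n)
  consider "k = 0" | "n < k" | "1 \<le> k" "k \<le> n" by linarith
  then show ?case
  proof cases
    case 1
    then show ?thesis
      by (simp add: sp_sum_def orth_sum_def paired_partitions_0 sp_weight_def orth_weight_def
          conj_sum_squares_def odd_parts_def sp_closed_simps orth_closed_simps)
  next
    case 2
    then show ?thesis
      by (auto simp: sp_sum_def orth_sum_def paired_partitions_empty sp_closed_def orth_closed_def
          gbinom_eq_0 elim!: evenE oddE)
  next
    case 3
    have IH: "sp_sum t l (n - k) = sp_closed t l (n - k)" "orth_sum t l (n - k) = orth_closed t l (n - k)" for l
      using less.IH[of "n - k"] 3 by auto
    show ?thesis
      unfolding sp_sum_rec[OF 3] orth_sum_rec[OF 3] IH
      using sp_closed_rec[OF 3(1), of "n - k"] orth_closed_rec[OF 3(1), of "n - k"] 3 by simp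
  qed
qed

text \<open>The factor \<open>1 - t\<^sup>k\<close> with \<open>k = 2j + 2\<close> is \<open>1 - Q\<^bsup>j+1\<^esup>\<close> and turns \<open>r\<^bsub>j+1\<^esub>\<close> into \<open>r\<^sub>j\<close>; together with
  the term for \<open>k = 2j + 1\<close> this gives \<open>Q\<^bsup>j(j+1)\<^esup> r\<^sub>j [m,j] (1 + Q\<^bsup>j+1\<^esup> - t Q\<^sup>j)\<close>.\<close>

lemma sum_one_minus_power_sp_sum:
  "(\<Sum>k\<le>2 * Suc m. (1 - t ^ k) * sp_sum t k (2 * Suc m)) = t ^ Suc m * (durfee_sum (t\<^sup>2) 1 m + (t\<^sup>2 - t) * durfee_sum (t\<^sup>2) 2 m)"
proof -
  let ?f = "\<lambda>k. (1 - t ^ k) * sp_closed t k (2 * Suc m)"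
  have "(\<Sum>k\<le>2 * Suc m. (1 - t ^ k) * sp_sum t k (2 * Suc m)) = (\<Sum>k\<le>2 * Suc m. ?f k)"
    using sums_eq_closed by simp
  also have "\<dots> = (\<Sum>j\<le>Suc m. ?f (2 * j)) + (\<Sum>j\<le>m. ?f (2 * j + 1))"
    by (rule sum_even_odd')
  also have "(\<Sum>j\<le>Suc m. ?f (2 * j)) = (\<Sum>j\<le>m. ?f (2 * Suc j))"
    unfolding sum.atMost_Suc_shift by simp
  also have "\<dots> + (\<Sum>j\<le>m. ?f (2 * j + 1)) = (\<Sum>j\<le>m. ?f (2 * Suc j) + ?f (2 * j + 1))"
    by (rule sum.distrib [symmetric])
  also have "\<dots> = (\<Sum>j\<le>m. t ^ Suc m * ((t\<^sup>2) ^ (j * (j + 1)) * inv_qpoch (t\<^sup>2) j * gbinom (t\<^sup>2) m j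
      + (t\<^sup>2 - t) * ((t\<^sup>2) ^ (j * (j + 2)) * inv_qpoch (t\<^sup>2) j * gbinom (t\<^sup>2) m j)))"
  proof (rule sum.cong)
    fix j
    have "?f (2 * Suc j) = t ^ Suc m * (t\<^sup>2) ^ (Suc j * Suc j) * ((1 - (t\<^sup>2) ^ Suc j) * inv_qpoch (t\<^sup>2) (Suc j)) * gbinom (t\<^sup>2) m j"
      unfolding sp_closed_simps by (simp add: power_mult [symmetric] del: power_Suc mult_Suc mult_Suc_right)
    also have "\<dots> = t ^ Suc m * (t\<^sup>2) ^ (Suc j * Suc j) * inv_qpoch (t\<^sup>2) j * gbinom (t\<^sup>2) m j"
      unfolding inv_qpoch_rec[OF generic, symmetric] ..
    finally have *: "?f (2 * Suc j) = t ^ Suc m * (t\<^sup>2) ^ (Suc j * Suc j) * inv_qpoch (t\<^sup>2) j * gbinom (t\<^sup>2) m j" .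
    have "?f (2 * j + 1) = t ^ Suc m * ((1 - t * (t\<^sup>2) ^ j) * (t\<^sup>2) ^ (j * (j + 1))) * inv_qpoch (t\<^sup>2) j * gbinom (t\<^sup>2) m j"
      unfolding sp_closed_simps by (simp add: power_mult [symmetric] power_add)
    then show "?f (2 * Suc j) + ?f (2 * j + 1) = t ^ Suc m * ((t\<^sup>2) ^ (j * (j + 1)) * inv_qpoch (t\<^sup>2) j * gbinom (t\<^sup>2) m j
      + (t\<^sup>2 - t) * ((t\<^sup>2) ^ (j * (j + 2)) * inv_qpoch (t\<^sup>2) j * gbinom (t\<^sup>2) m j))"
      unfolding * by (simp add: algebra_simps power_add numeral_eq_Suc)
  qed simp
  also have "\<dots> = t ^ Suc m * (durfee_sum (t\<^sup>2) 1 m + (t\<^sup>2 - t) * durfee_sum (t\<^sup>2) 2 m)"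
    by (simp add: durfee_sum_def sum.distrib sum_distrib_left distrib_left)
  finally show ?thesis .
qed

end

section \<open>The identity\<close>

lemma qvar_power: "qvar ^ k = to_fract ([:0, 1:] ^ k)"
  by (induction k) (simp_all add: qvar_def del: mult_pCons_left)

lemma qvar_power_ne_1: "qvar ^ Suc k \<noteq> 1"
proof -
  have "degree ([:0, 1:] ^ Suc k :: rat poly) = Suc k"
    by (simp add: degree_power_eq)
  then have "[:0, 1:] ^ Suc k \<noteq> (1 :: rat poly)" by (metis degree_1 nat.distinct(1))
  then show ?thesis
    unfolding qvar_power to_fract_1 [symmetric] to_fract_eq_iff .
qed

lemma sum_sp_partitions:
  fixes q t :: "'a::field"
  defines "t \<equiv> 1 / q"
  shows "(\<Sum>\<mu> \<in> {\<mu> \<in> partitions_of (2 * m). \<forall>i. odd i \<longrightarrow> even (count \<mu> i)}.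
            (1 - 1 / q ^ conj_part \<mu> 1) /
            (q ^ (conj_sum_squares \<mu> div 2 + odd_parts \<mu> div 2) *
             (\<Prod>i = 1..2 * m. qpoch (1 / q\<^sup>2) (1 / q\<^sup>2) (count \<mu> i div 2))))
       = (\<Sum>k\<le>2 * m. (1 - t ^ k) * sp_sum t k (2 * m))"
proof -
  let ?A = "{\<mu> \<in> partitions_of (2 * m). \<forall>i. odd i \<longrightarrow> even (count \<mu> i)}"
  have term_eq: "(1 - 1 / q ^ conj_part \<mu> 1) /
            (q ^ (conj_sum_squares \<mu> div 2 + odd_parts \<mu> div 2) *
             (\<Prod>i = 1..2 * m. qpoch (1 / q\<^sup>2) (1 / q\<^sup>2) (count \<mu> i div 2)))
        = (1 - t ^ size \<mu>) * sp_weight t \<mu>" if "\<mu> \<in> ?A" for \<mu>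
  proof -
    have nz: "0 \<notin># \<mu>" and n: "sum_mset \<mu> = 2 * m" using that by (auto simp: partitions_of_def)
    have "(conj_sum_squares \<mu> + odd_parts \<mu>) div 2 = conj_sum_squares \<mu> div 2 + odd_parts \<mu> div 2"
      using even_conj_sum_squares[of \<mu>] n by (simp add: div_plus_div_distrib_dvd_left)
    then show ?thesis
      unfolding sp_weight_def conj_part_1[OF nz] t_def n inv_qpoch_def
      by (simp add: divide_inverse power_inverse prod_inversef[unfolded o_def] mult_ac)
  qed
  have fin: "finite ?A" using finite_partitions_of by simp
  have le: "size \<mu> \<le> 2 * m" if "\<mu> \<in> ?A" for \<mu>
    using that size_le_sum_mset[of \<mu>] by (auto simp: partitions_of_def)
  have "sum (\<lambda>\<mu>. (1 - t ^ size \<mu>) * sp_weight t \<mu>) ?A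
      = (\<Sum>k\<le>2 * m. \<Sum>\<mu>\<in>{\<mu> \<in> ?A. size \<mu> = k}. (1 - t ^ size \<mu>) * sp_weight t \<mu>)"
    using fin le by (intro sum.group [symmetric]) auto
  also have "\<dots> = (\<Sum>k\<le>2 * m. (1 - t ^ k) * sp_sum t k (2 * m))"
    unfolding sp_sum_def sum_distrib_left
    by (intro sum.cong refl) (auto simp: paired_partitions_def)
  finally show ?thesis using term_eq by simp
qed

theorem mainTheorem1:
  fixes m :: nat and q :: "rat poly fract"
  assumes "q = qvar" and "m \<ge> 1"
  shows "(\<Sum>\<mu> \<in> {\<mu> \<in> partitions_of (2 * m). \<forall>i. odd i \<longrightarrow> even (count \<mu> i)}.
            (1 - 1 / q ^ conj_part \<mu> 1) /
            (q ^ (conj_sum_squares \<mu> div 2 + odd_parts \<mu> div 2) *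
             (\<Prod>i = 1..2 * m. qpoch (1 / q\<^sup>2) (1 / q\<^sup>2) (count \<mu> i div 2))))
       = 1 / (q ^ m * (q + 1)) *
         (\<Sum>i = 1..m. (- 1) ^ (i - 1) * (q ^ (2 * i + 1) + 1) /
            (q ^ (i * (i + 1)) * qpoch (1 / q\<^sup>2) (1 / q\<^sup>2) (m - i)))"
proof -
  define t where "t = 1 / q"
  let ?Q = "t\<^sup>2"
  have q0: "q \<noteq> 0" using assms(1) by (simp add: qvar_def)
  have "q\<^sup>2 \<noteq> 1" using qvar_power_ne_1[of 1] assms(1) by (simp add: power2_eq_square)
  then have q1: "q + 1 \<noteq> 0" by (auto simp: add_eq_0_iff2 power2_eq_1_iff)
  have generic: "?Q ^ Suc k \<noteq> 1" for k
    using qvar_power_ne_1[of "2 * k + 1"] assms(1)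
    by (simp add: t_def power_one_over power_mult [symmetric] del: power_Suc)
  obtain M where m: "m = Suc M" using assms(2) by (cases m) auto
  have term_eq: "(- 1) ^ (Suc i - 1) * (q ^ (2 * Suc i + 1) + 1) /
            (q ^ (Suc i * (Suc i + 1)) * qpoch (1 / q\<^sup>2) (1 / q\<^sup>2) (m - Suc i))
      = q * ((- 1) ^ i * ?Q ^ (Suc i choose 2) * (1 + t * ?Q ^ Suc i) * inv_qpoch ?Q (M - i))" for i
  proof -
    let ?P = "q ^ (2 * i + 2)" and ?R = "q ^ (i * (i + 1))"
    have R: "?Q ^ (Suc i choose 2) = 1 / ?R"
    proof -
      have "2 * (Suc i choose 2) = i * (i + 1)" by (simp add: choose_two)
      then show ?thesis by (simp only: t_def power_one_over power_mult [symmetric])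
    qed
    have P: "?Q ^ Suc i = 1 / ?P"
      by (simp add: t_def power_one_over power_mult [symmetric] del: power_Suc)
    have 1: "q ^ (2 * Suc i + 1) = q * ?P" by simp
    have 2: "q ^ (Suc i * (Suc i + 1)) = ?P * ?R"
      unfolding power_add [symmetric]
      by (rule arg_cong2[where f = power]) (simp_all add: algebra_simps)
    have 3: "qpoch (1 / q\<^sup>2) (1 / q\<^sup>2) (m - Suc i) = qpoch ?Q ?Q (M - i)"
      by (simp add: m t_def power_one_over)
    have "(q * ?P + 1) / ?P = q * (1 + t * (1 / ?P))"
      using q0 by (simp add: t_def field_simps)
    then have 4: "e * (q * ?P + 1) / (?P * x * c) = q * (e * (1 / x) * (1 + t * (1 / ?P)) * inverse c)" for e x c
      by (simp only: divide_inverse inverse_mult_distrib mult_ac mult_1_left)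
    have "(- 1) ^ (Suc i - 1) = (- 1 :: rat poly fract) ^ i" by simp
    then show ?thesis
      unfolding R P 1 2 3 inv_qpoch_def by (simp only: 4)
  qed
  have "(\<Sum>i = 1..m. (- 1) ^ (i - 1) * (q ^ (2 * i + 1) + 1) /
            (q ^ (i * (i + 1)) * qpoch (1 / q\<^sup>2) (1 / q\<^sup>2) (m - i)))
      = (\<Sum>i\<le>M. q * ((- 1) ^ i * ?Q ^ (Suc i choose 2) * (1 + t * ?Q ^ Suc i) * inv_qpoch ?Q (M - i)))"
    unfolding term_eq [symmetric]
    by (rule sum.reindex_bij_witness[where i = Suc and j = "\<lambda>i. i - 1"]) (auto simp: m)
  also have "\<dots> = q * ((1 + t) * (durfee_sum ?Q 1 M + (?Q - t) * durfee_sum ?Q 2 M))"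
    unfolding sum_distrib_left [symmetric] durfee_sums_eq_partial_theta[OF generic refl] ..
  also have "\<dots> = (q + 1) * (durfee_sum ?Q 1 M + (?Q - t) * durfee_sum ?Q 2 M)"
    using q0 by (simp add: t_def field_simps)
  finally have rhs: "(\<Sum>i = 1..m. (- 1) ^ (i - 1) * (q ^ (2 * i + 1) + 1) /
            (q ^ (i * (i + 1)) * qpoch (1 / q\<^sup>2) (1 / q\<^sup>2) (m - i)))
      = (q + 1) * (durfee_sum ?Q 1 M + (?Q - t) * durfee_sum ?Q 2 M)" .
  have lhs: "(\<Sum>k\<le>2 * m. (1 - t ^ k) * sp_sum t k (2 * m)) = t ^ m * (durfee_sum ?Q 1 M + (?Q - t) * durfee_sum ?Q 2 M)"
    unfolding m by (rule sum_one_minus_power_sp_sum[OF generic])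
  show ?thesis
    unfolding sum_sp_partitions t_def [symmetric] lhs rhs
    using q1 by (simp add: t_def power_one_over)
qed

end
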